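(* Let $(W,S)$ be a Coxeter system and let $F\in\mathrm{Mac}(W)$. Assume that for every $F'\in\mathrm{Mac}(W)$ with $F'\leq_{\mathsf L}F$, the minimal elements of $F'$ (in Bruhat order) all have the same Coxeter length. Then $\Delta(\mathsf Q,F)$ is vertex-decomposable for every finite word $\mathsf Q$ over $S$.
   Context: $W$ carries the Bruhat order $\leq_{\mathsf B}$. $\mathrm{Mac}(W)$ is the set of order filters $F$ of $W$ with $F=\mathrm{U}(\mathrm{L}(F))$, where for $X\subseteq W$, $\mathrm{U}(X)$ (resp. $\mathrm{L}(X)$) is the set of elements $\geq$ (resp. $\leq$) every element of $X$. For $s\in S$, $\pi_s(w)=sw$ if $\ell(sw)<\ell(w)$ and $\pi_s(w)=w$ otherwise; for $u\in W$, $\pi_u=\pi_{s_1}\cdots\pi_{s_k}$ for a reduced word $s_1\cdots s_k$ of $u$. For $F\in\mathrm{Mac}(W)$, $\tau_u(F)=\{w\in W: \pi_u(x)\leq_{\mathsf B}w\text{ for some }x\in F\}$ (this lies in $\mathrm{Mac}(W)$). Write $F'\leq_{\mathsf L}F$ if $F'=\tau_u(F)$ for some $u\in W$. A finite word $\mathsf Q$ over $S$ is a function from a finite set $V\subset\mathbb Z$ to $S$, read in increasing order of indices; $\mathsf Q|_{V'}$ is its restriction. For $w\in W$, the subword complex $\Delta(\mathsf Q,w)$ is the simplicial complex on vertex set $V$ whose faces are the $D\subseteq V$ such that $\mathsf Q|_{V\setminus D}$ contains (as a subword) a reduced word for $w$. Set $\Delta(\mathsf Q,F)=\bigcup_{w\in\min(F)}\Delta(\mathsf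 Q,w)$. For a simplicial complex $\Delta$ and vertex $v$, $\mathrm{del}_v(\Delta)=\{D\in\Delta:v\notin D\}$ and $\mathrm{lk}_v(\Delta)=\{D\in\mathrm{del}_v(\Delta): D\cup\{v\}\in\Delta\}$. $\Delta$ is vertex-decomposable if it is empty or a simplex (has a unique facet), or there is a vertex $v$ such that $\mathrm{del}_v(\Delta)$ and $\mathrm{lk}_v(\Delta)$ are vertex-decomposable and every facet of $\mathrm{del}_v(\Delta)$ is a facet of $\Delta$. *)

theory Defs
  imports "HOL-Algebra.Generated_Groups" "HOL-Library.Sublist"
begin

section \<open>Coxeter systems\<close>

text \<open>A word over \<open>S\<close> is a list. A Coxeter matrix takes values in \<open>{1, 2, ...}\<close> together with
  infinity; infinity is encoded as \<open>0\<close>, so that the corresponding relator is the empty word.\<close>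

definition coxeter_matrix :: "'a set \<Rightarrow> ('a \<Rightarrow> 'a \<Rightarrow> nat) \<Rightarrow> bool" where
  "coxeter_matrix S m \<longleftrightarrow>
     (\<forall>s\<in>S. m s s = 1) \<and>
     (\<forall>s\<in>S. \<forall>t\<in>S. m s t = m t s) \<and>
     (\<forall>s\<in>S. \<forall>t\<in>S. s \<noteq> t \<longrightarrow> m s t \<noteq> 1)"

definition relator :: "('a \<Rightarrow> 'a \<Rightarrow> nat) \<Rightarrow> 'a \<Rightarrow> 'a \<Rightarrow> 'a list" where
  "relator m s t = concat (replicate (m s t) [s, t])"

definition relator_deletion :: "'a set \<Rightarrow> ('a \<Rightarrow> 'a \<Rightarrow> nat) \<Rightarrow> 'a list \<Rightarrow> 'a list \<Rightarrow> bool" where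
  "relator_deletion S m xs ys \<longleftrightarrow>
     (\<exists>as\<in>lists S. \<exists>bs\<in>lists S. \<exists>s\<in>S. \<exists>t\<in>S.
        xs = as @ relator m s t @ bs \<and> ys = as @ bs)"

definition word_prod :: "('a, 'b) monoid_scheme \<Rightarrow> 'a list \<Rightarrow> 'a" where
  "word_prod W ws = foldr (\<otimes>\<^bsub>W\<^esub>) ws \<one>\<^bsub>W\<^esub>"

text \<open>\<open>W\<close> is the group presented by the generators \<open>S\<close> and the relators \<open>(s t)\<^bsup>m(s,t)\<^esup>\<close>. Since
  \<open>s s\<close> is among the relators, inverses of generators are not needed in words, and the
  presented group is the free monoid on \<open>S\<close> modulo insertion and deletion of relators.\<close>

definition coxeter_system :: "('a, 'b) monoid_scheme \<Rightarrow> 'a set \<Rightarrow> bool" where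
  "coxeter_system W S \<longleftrightarrow>
     group W \<and> S \<subseteq> carrier W \<and> generate W S = carrier W \<and>
     (\<exists>m. coxeter_matrix S m \<and>
        (\<forall>xs\<in>lists S. \<forall>ys\<in>lists S.
           word_prod W xs = word_prod W ys \<longleftrightarrow> equivclp (relator_deletion S m) xs ys))"

definition cox_length :: "('a, 'b) monoid_scheme \<Rightarrow> 'a set \<Rightarrow> 'a \<Rightarrow> nat" where
  "cox_length W S w = (LEAST n. \<exists>ws\<in>lists S. length ws = n \<and> word_prod W ws = w)"

definition reduced_word :: "('a, 'b) monoid_scheme \<Rightarrow> 'a set \<Rightarrow> 'a \<Rightarrow> 'a list \<Rightarrow> bool" where
  "reduced_word W S w ws \<longleftrightarrow>
     ws \<in> lists S \<and> word_prod W ws = w \<and> length ws = cox_length W S w"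

section \<open>Bruhat order and its MacNeille completion\<close>

definition reflections :: "('a, 'b) monoid_scheme \<Rightarrow> 'a set \<Rightarrow> 'a set" where
  "reflections W S = {w \<otimes>\<^bsub>W\<^esub> s \<otimes>\<^bsub>W\<^esub> inv\<^bsub>W\<^esub> w | w s. w \<in> carrier W \<and> s \<in> S}"

definition bruhat_step :: "('a, 'b) monoid_scheme \<Rightarrow> 'a set \<Rightarrow> 'a \<Rightarrow> 'a \<Rightarrow> bool" where
  "bruhat_step W S u v \<longleftrightarrow>
     (\<exists>t\<in>reflections W S. v = t \<otimes>\<^bsub>W\<^esub> u \<and> cox_length W S u < cox_length W S v)"

definition bruhat_le :: "('a, 'b) monoid_scheme \<Rightarrow> 'a set \<Rightarrow> 'a \<Rightarrow> 'a \<Rightarrow> bool" where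
  "bruhat_le W S u v \<longleftrightarrow>
     u \<in> carrier W \<and> v \<in> carrier W \<and> (bruhat_step W S)\<^sup>*\<^sup>* u v"

definition upper_bounds :: "('a, 'b) monoid_scheme \<Rightarrow> 'a set \<Rightarrow> 'a set \<Rightarrow> 'a set" where
  "upper_bounds W S A = {w \<in> carrier W. \<forall>x\<in>A. bruhat_le W S x w}"

definition lower_bounds :: "('a, 'b) monoid_scheme \<Rightarrow> 'a set \<Rightarrow> 'a set \<Rightarrow> 'a set" where
  "lower_bounds W S A = {w \<in> carrier W. \<forall>x\<in>A. bruhat_le W S w x}"

definition order_filter :: "('a, 'b) monoid_scheme \<Rightarrow> 'a set \<Rightarrow> 'a set \<Rightarrow> bool" where
  "order_filter W S F \<longleftrightarrow>
     F \<subseteq> carrier W \<and> (\<forall>x\<in>F. \<forall>y\<in>carrier W. bruhat_le W S x y \<longrightarrow> y \<in> F)"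

definition Mac :: "('a, 'b) monoid_scheme \<Rightarrow> 'a set \<Rightarrow> 'a set set" where
  "Mac W S = {F. order_filter W S F \<and> F = upper_bounds W S (lower_bounds W S F)}"

definition min_elements :: "('a, 'b) monoid_scheme \<Rightarrow> 'a set \<Rightarrow> 'a set \<Rightarrow> 'a set" where
  "min_elements W S F = {x \<in> F. \<forall>y\<in>F. bruhat_le W S y x \<longrightarrow> y = x}"

definition pi_gen :: "('a, 'b) monoid_scheme \<Rightarrow> 'a set \<Rightarrow> 'a \<Rightarrow> 'a \<Rightarrow> 'a" where
  "pi_gen W S s w =
     (if cox_length W S (s \<otimes>\<^bsub>W\<^esub> w) < cox_length W S w then s \<otimes>\<^bsub>W\<^esub> w else w)"

text \<open>The operators \<open>pi_gen\<close> satisfy the braid relations, so the choice of the reduced word is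
  immaterial.\<close>

definition pi_elt :: "('a, 'b) monoid_scheme \<Rightarrow> 'a set \<Rightarrow> 'a \<Rightarrow> 'a \<Rightarrow> 'a" where
  "pi_elt W S u = foldr (pi_gen W S) (SOME ws. reduced_word W S u ws)"

definition tau :: "('a, 'b) monoid_scheme \<Rightarrow> 'a set \<Rightarrow> 'a \<Rightarrow> 'a set \<Rightarrow> 'a set" where
  "tau W S u F = {w \<in> carrier W. \<exists>x\<in>F. bruhat_le W S (pi_elt W S u x) w}"

definition left_le :: "('a, 'b) monoid_scheme \<Rightarrow> 'a set \<Rightarrow> 'a set \<Rightarrow> 'a set \<Rightarrow> bool" where
  "left_le W S F' F \<longleftrightarrow> (\<exists>u\<in>carrier W. F' = tau W S u F)"

section \<open>Vertex-decomposable complexes\<close>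

text \<open>A simplicial complex is represented by its set of faces. The void complex \<open>{}\<close> and the
  complex \<open>{{}}\<close> are distinct.\<close>

definition facets :: "'v set set \<Rightarrow> 'v set set" where
  "facets \<Delta> = {D \<in> \<Delta>. \<forall>E\<in>\<Delta>. D \<subseteq> E \<longrightarrow> E = D}"

definition deletion :: "'v \<Rightarrow> 'v set set \<Rightarrow> 'v set set" where
  "deletion v \<Delta> = {D \<in> \<Delta>. v \<notin> D}"

definition link :: "'v \<Rightarrow> 'v set set \<Rightarrow> 'v set set" where
  "link v \<Delta> = {D \<in> deletion v \<Delta>. insert v D \<in> \<Delta>}"

text \<open>In the last rule, allowing an element \<open>v\<close> of the ground set that lies in no face would not
  change the notion, since then \<open>deletion v \<Delta> = \<Delta>\<close>.\<close>

inductive vertex_decomposable :: "'v set set \<Rightarrow> bool" where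
  void: "vertex_decomposable {}"
| simplex: "\<exists>!D. D \<in> facets \<Delta> \<Longrightarrow> vertex_decomposable \<Delta>"
| vertex: "\<lbrakk>v \<in> \<Union>\<Delta>; vertex_decomposable (deletion v \<Delta>); vertex_decomposable (link v \<Delta>);
      facets (deletion v \<Delta>) \<subseteq> facets \<Delta>\<rbrakk> \<Longrightarrow> vertex_decomposable \<Delta>"

section \<open>Subword complexes\<close>

text \<open>A finite word over \<open>S\<close> is given by a finite index set \<open>V\<close> and a function \<open>Q\<close> whose values
  outside \<open>V\<close> are irrelevant.\<close>

definition restricted_word :: "(int \<Rightarrow> 'a) \<Rightarrow> int set \<Rightarrow> 'a list" where
  "restricted_word Q V = map Q (sorted_list_of_set V)"

definition subword_complex ::
    "('a, 'b) monoid_scheme \<Rightarrow> 'a set \<Rightarrow> int set \<Rightarrow> (int \<Rightarrow> 'a) \<Rightarrow> 'a \<Rightarrow> int set set" where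
  "subword_complex W S V Q w =
     {D. D \<subseteq> V \<and> (\<exists>ws. reduced_word W S w ws \<and> subseq ws (restricted_word Q (V - D)))}"

definition filter_subword_complex ::
    "('a, 'b) monoid_scheme \<Rightarrow> 'a set \<Rightarrow> int set \<Rightarrow> (int \<Rightarrow> 'a) \<Rightarrow> 'a set \<Rightarrow> int set set" where
  "filter_subword_complex W S V Q F = (\<Union>w\<in>min_elements W S F. subword_complex W S V Q w)"

end

theory Submission
  imports Defs
begin

text \<open>A set \<open>D\<close> is a face of \<open>\<Delta>(Q, F)\<close> exactly if the Demazure product of the letters outside \<open>D\<close>
  lies in the filter \<open>F\<close>. Let \<open>v\<close> be the first position of \<open>Q\<close>, \<open>s\<close> its letter and \<open>Q'\<close> the rest of
  the word. Then the link of \<open>v\<close> is \<open>\<Delta>(Q', F)\<close>, and the deletion of \<open>v\<close> is \<open>\<Delta>(Q', F')\<close>, where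
  \<open>F' = {w. s * w \<in> F}\<close> and \<open>s * w\<close> is the longer of \<open>w\<close> and \<open>s w\<close>. Since \<open>\<pi>\<^sub>s x \<le> w\<close> iff \<open>x \<le> s * w\<close>, this \<open>F'\<close> is \<open>\<tau>\<^sub>s F\<close>, so one can induct on
  the word. If \<open>F' = F\<close>, the complex is a cone with apex \<open>v\<close>. Otherwise some minimal element of \<open>F\<close>
  is shortened by \<open>s\<close>, so by purity the minimal elements of \<open>F'\<close> are shorter than those of \<open>F\<close>, and
  hence the complement of a facet of the deletion is too short to contain a reduced word of an
  element of \<open>F\<close>. The needed facts on the Bruhat order follow from the reflection cocycle, which
  is well defined because every reflection occurs an even number of times in a relator.\<close>

section \<open>Cones and restricted words\<close>

lemma word_prod_Nil [simp]: "word_prod W [] = \<one>\<^bsub>W\<^esub>"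
  and word_prod_Cons [simp]: "word_prod W (s # ws) = s \<otimes>\<^bsub>W\<^esub> word_prod W ws"
  by (simp_all add: word_prod_def)

text \<open>The family on the left is the cone over \<open>\<Gamma>\<close> with apex
  \<open>v\<close>. Adding \<open>v\<close> to \<open>E\<close> does not change
  \<open>E - {v}\<close>, so every maximal face contains the apex.\<close>

lemma facets_cone:
  assumes "v \<notin> \<Union>\<Gamma>" shows "facets {D. D - {v} \<in> \<Gamma>} = insert v ` facets \<Gamma>"
proof (intro Set.set_eqI iffI)
  fix E assume E: "E \<in> facets {D. D - {v} \<in> \<Gamma>}"
  then have "insert v E - {v} \<in> \<Gamma>" by (simp add: facets_def)
  then have "insert v E = E"
    using E unfolding facets_def by (simp add: subset_insertI)
  moreover have "E - {v} \<in> facets \<Gamma>"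
    unfolding facets_def
  proof (intro CollectI conjI ballI impI)
    show "E - {v} \<in> \<Gamma>" using E by (simp add: facets_def)
    fix D assume D: "D \<in> \<Gamma>" "E - {v} \<subseteq> D"
    then have "v \<notin> D" using assms by auto
    then have "insert v D - {v} \<in> \<Gamma>" "E \<subseteq> insert v D" using D by auto
    then have "insert v D = E" using E by (auto simp: facets_def)
    then show "D = E - {v}" using \<open>v \<notin> D\<close> by auto
  qed
  ultimately show "E \<in> insert v ` facets \<Gamma>" by (metis image_eqI insert_Diff_single)
next
  fix E assume "E \<in> insert v ` facets \<Gamma>"
  then obtain D where D: "D \<in> facets \<Gamma>" "E = insert v D" by blast
  then have v: "v \<notin> D" using assms by (auto simp: facets_def)
  show "E \<in> facets {D. D - {v} \<in> \<Gamma>}"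
    unfolding facets_def
  proof (intro CollectI conjI ballI impI)
    show "E - {v} \<in> \<Gamma>" using D v by (simp add: facets_def)
    fix E' assume E': "E' \<in> {D. D - {v} \<in> \<Gamma>}" "E \<subseteq> E'"
    then have "D \<subseteq> E' - {v}" using D v by auto
    then have "E' - {v} = D" using D E' by (auto simp: facets_def)
    then show "E' = E" using D E' by auto
  qed
qed

text \<open>Deletion and link of a vertex \<open>x \<noteq> v\<close> commute with coning, and so
  does taking facets. Hence each decomposition step of \<open>\<Gamma>\<close> is also one of the
  cone.\<close>

lemma vertex_decomposable_cone:
  "vertex_decomposable \<Gamma> \<Longrightarrow> v \<notin> \<Union>\<Gamma> \<Longrightarrow> vertex_decomposable {D. D - {v} \<in> \<Gamma>}"
proof (induction rule: vertex_decomposable.induct)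
  case void
  then show ?case by (simp add: vertex_decomposable.void)
next
  case (simplex \<Gamma>)
  then obtain D where "facets \<Gamma> = {D}" by blast
  then show ?case
    using simplex by (intro vertex_decomposable.simplex) (simp add: facets_cone)
next
  case (vertex x \<Gamma>)
  let ?C = "{D. D - {v} \<in> \<Gamma>}"
  have "x \<noteq> v" using vertex by auto
  have del: "deletion x ?C = {D. D - {v} \<in> deletion x \<Gamma>}"
    using \<open>x \<noteq> v\<close> by (auto simp: deletion_def)
  have link: "link x ?C = {D. D - {v} \<in> link x \<Gamma>}"
    using \<open>x \<noteq> v\<close> by (auto simp: link_def del insert_Diff_if)
  have v: "v \<notin> \<Union>(deletion x \<Gamma>)" "v \<notin> \<Union>(link x \<Gamma>)"
    using vertex.prems by (auto simp: deletion_def link_def)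
  have "x \<in> \<Union>?C"
  proof -
    obtain D where D: "D \<in> \<Gamma>" "x \<in> D" using vertex.hyps by blast
    then have "D - {v} = D" using vertex.prems by auto
    then show ?thesis using D by (intro UnionI[of D]) simp_all
  qed
  moreover have "vertex_decomposable (deletion x ?C)" "vertex_decomposable (link x ?C)"
    unfolding del link using vertex.IH v by simp_all
  moreover have "facets (deletion x ?C) \<subseteq> facets ?C"
    using \<open>facets (deletion x \<Gamma>) \<subseteq> facets \<Gamma>\<close>
    unfolding del facets_cone[OF v(1)] facets_cone[OF vertex.prems] by (rule image_mono)
  ultimately show ?case by (rule vertex_decomposable.vertex)
qed

section \<open>Subwords as sets of positions\<close>

lemma restricted_word_insert:
  assumes "finite V" "\<And>a. a \<in> V \<Longrightarrow> v < a"
  shows "restricted_word Q (insert v V) = Q v # restricted_word Q V"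
proof -
  have "v \<notin> V" using assms by blast
  moreover have "insort v (sorted_list_of_set V) = v # sorted_list_of_set V"
    using assms by (intro insort_is_Cons) (auto intro: less_imp_le)
  ultimately show ?thesis using assms by (simp add: restricted_word_def)
qed

lemma subseq_restricted_word:
  "finite B \<Longrightarrow> A \<subseteq> B \<Longrightarrow> subseq (restricted_word Q A) (restricted_word Q B)"
proof (induction B arbitrary: A rule: finite_linorder_min_induct)
  case empty
  then show ?case by simp
next
  case (insert b B)
  have "subseq (restricted_word Q (A - {b})) (restricted_word Q B)"
    using insert by (intro insert.IH) auto
  moreover have "restricted_word Q A = Q b # restricted_word Q (A - {b})" if "b \<in> A"
  proof -
    have "finite (A - {b})" using insert finite_subset[of "A - {b}" B] by auto
    moreover have "b < a" if "a \<in> A - {b}" for a using that insert by auto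
    moreover have "insert b (A - {b}) = A" using that by auto
    ultimately show ?thesis using restricted_word_insert[of "A - {b}" b Q] by simp
  qed
  moreover have "A - {b} = A" if "b \<notin> A" using that by simp
  ultimately show ?case
    using insert restricted_word_insert[of B b Q] by (cases "b \<in> A") auto
qed

text \<open>Faces are sets of positions, so a subword has to be traced back to the positions that
  carry it.\<close>

lemma subseq_restricted_wordE:
  assumes "subseq ws (restricted_word Q A)" "finite A"
  obtains E where "E \<subseteq> A" "restricted_word Q E = ws"
proof -
  obtain N where N: "ws = nths (restricted_word Q A) N"
    using assms by (auto simp: subseq_conv_nths)
  let ?l = "nths (sorted_list_of_set A) N"
  have "sorted_list_of_set (set ?l) = ?l"
    by (intro sorted_list_of_set.idem_if_sorted_distinct) (auto simp: sorted_nths distinct_nthsI)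
  then have "restricted_word Q (set ?l) = ws"
    by (simp add: N restricted_word_def nths_map)
  moreover have "set ?l \<subseteq> A" using set_nths_subset assms(2) by fastforce
  ultimately show thesis using that by blast
qed

section \<open>Coxeter groups\<close>

locale coxeter = group W for W :: "('a, 'b) monoid_scheme" (structure) +
  fixes S :: "'a set"
  assumes coxeter_system: "coxeter_system W S"
begin

abbreviation len :: "'a \<Rightarrow> nat" where "len \<equiv> cox_length W S"

abbreviation bruhat (infix "\<preceq>" 50) where "u \<preceq> v \<equiv> bruhat_le W S u v"

lemma S_closed [simp]: "s \<in> S \<Longrightarrow> s \<in> carrier W"
  using coxeter_system by (auto simp: coxeter_system_def)

lemma word_prod_closed [simp]: "ws \<in> lists S \<Longrightarrow> word_prod W ws \<in> carrier W"
  by (induction ws) auto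

lemma word_prod_append:
  "xs \<in> lists S \<Longrightarrow> ys \<in> lists S \<Longrightarrow> word_prod W (xs @ ys) = word_prod W xs \<otimes> word_prod W ys"
  by (induction xs) (auto simp: m_assoc)

definition presenting_matrix :: "('a \<Rightarrow> 'a \<Rightarrow> nat) \<Rightarrow> bool" where
  "presenting_matrix m \<longleftrightarrow> coxeter_matrix S m \<and>
     (\<forall>xs\<in>lists S. \<forall>ys\<in>lists S.
        word_prod W xs = word_prod W ys \<longleftrightarrow> equivclp (relator_deletion S m) xs ys)"

lemma presentation: obtains m where "presenting_matrix m"
  using coxeter_system unfolding coxeter_system_def presenting_matrix_def by blast

lemma replicate_in_lists: "s \<in> S \<Longrightarrow> t \<in> S \<Longrightarrow> concat (replicate k [s, t]) \<in> lists S"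
  by (induction k) auto

lemma relator_in_lists: "s \<in> S \<Longrightarrow> t \<in> S \<Longrightarrow> relator m s t \<in> lists S"
  by (simp add: relator_def replicate_in_lists)

lemma relator_trivial:
  assumes "presenting_matrix m" "s \<in> S" "t \<in> S"
  shows "word_prod W (relator m s t) = \<one>"
proof -
  have "relator_deletion S m (relator m s t) []"
    unfolding relator_deletion_def using assms(2,3)
    by (intro bexI[of _ "[]"] bexI[of _ s] bexI[of _ t]) auto
  then have "equivclp (relator_deletion S m) (relator m s t) []"
    by (rule r_into_equivclp)
  then show ?thesis
    using assms relator_in_lists[of s t m] unfolding presenting_matrix_def
    by (metis lists.Nil word_prod_Nil)
qed

lemma S_square [simp]:
  assumes "s \<in> S" shows "s \<otimes> s = \<one>"
proof -
  obtain m where m: "presenting_matrix m"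
    by (rule presentation)
  have "relator m s s = [s, s]"
    using m assms by (simp add: presenting_matrix_def coxeter_matrix_def relator_def)
  then show ?thesis
    using relator_trivial[OF m assms assms] assms by simp
qed

lemma S_cancel [simp]: "s \<in> S \<Longrightarrow> x \<in> carrier W \<Longrightarrow> s \<otimes> (s \<otimes> x) = x"
  by (simp flip: m_assoc)

lemma S_cancel_right [simp]: "s \<in> S \<Longrightarrow> x \<in> carrier W \<Longrightarrow> x \<otimes> s \<otimes> s = x"
  by (simp add: m_assoc)

lemma S_inv [simp]: "s \<in> S \<Longrightarrow> inv s = s"
  by (simp add: inv_equality)

lemma word_exists:
  assumes "w \<in> carrier W" obtains ws where "ws \<in> lists S" "word_prod W ws = w"
proof -
  have "w \<in> generate W S"
    using assms coxeter_system by (simp add: coxeter_system_def)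
  then have "\<exists>ws\<in>lists S. word_prod W ws = w"
  proof induction
    case one
    show ?case by (auto intro: bexI[of _ "[]"])
  next
    case (incl s)
    then show ?case by (intro bexI[of _ "[s]"]) auto
  next
    case (inv s)
    then show ?case by (intro bexI[of _ "[s]"]) auto
  next
    case (eng x y)
    then obtain xs ys where "xs \<in> lists S" "ys \<in> lists S" "word_prod W xs = x" "word_prod W ys = y"
      by blast
    then show ?case
      by (intro bexI[of _ "xs @ ys"]) (auto simp: word_prod_append)
  qed
  then show thesis using that by blast
qed

lemma word_prod_rev: "ws \<in> lists S \<Longrightarrow> word_prod W (rev ws) = inv (word_prod W ws)"
proof (induction ws)
  case (Cons s ws)
  then show ?case
    by (simp add: word_prod_append[of "rev ws" "[s]"] inv_mult_group in_lists_conv_set)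
qed simp

section \<open>The reflection cocycle\<close>

text \<open>\<open>flips (s\<^sub>1 \<dots> s\<^sub>k) t\<close> says that \<open>t\<close> occurs an odd number of times among the
  \<open>s\<^sub>1 \<dots> s\<^sub>i \<dots> s\<^sub>1\<close>.\<close>

primrec flips :: "'a list \<Rightarrow> 'a \<Rightarrow> bool" where
  "flips [] t \<longleftrightarrow> False"
| "flips (s # ws) t \<longleftrightarrow> (t = s) \<noteq> flips ws (s \<otimes> t \<otimes> s)"

text \<open>The cocycle rule: in a concatenation, the reflections of the second word appear
  conjugated by the product of the first.\<close>

lemma flips_append:
  "xs \<in> lists S \<Longrightarrow> t \<in> carrier W \<Longrightarrow>
   flips (xs @ ys) t \<longleftrightarrow> flips xs t \<noteq> flips ys (inv (word_prod W xs) \<otimes> t \<otimes> word_prod W xs)"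
  by (induction xs arbitrary: t) (auto simp: inv_mult_group m_assoc)

lemma conj_eq_iff:
  "x \<in> carrier W \<Longrightarrow> r \<in> carrier W \<Longrightarrow> y \<in> carrier W \<Longrightarrow>
   inv x \<otimes> r \<otimes> x = y \<longleftrightarrow> r = x \<otimes> y \<otimes> inv x"
  by (metis inv_closed inv_solve_left inv_solve_right' m_assoc m_closed)

text \<open>In the dihedral group generated by \<open>s\<close> and \<open>t\<close>, conjugation by
  \<open>s\<close> inverts the rotation \<open>s \<otimes> t\<close>.\<close>

lemma S_conj_pow:
  assumes "s \<in> S" "t \<in> S"
  shows "s \<otimes> inv ((s \<otimes> t) [^] (k::nat)) = (s \<otimes> t) [^] k \<otimes> s"
proof (induction k)
  case (Suc k)
  have "s \<otimes> inv ((s \<otimes> t) [^] Suc k) = s \<otimes> (t \<otimes> s) \<otimes> inv ((s \<otimes> t) [^] k)"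
    using assms by (simp add: inv_mult_group m_assoc)
  also have "\<dots> = (s \<otimes> t) \<otimes> (s \<otimes> inv ((s \<otimes> t) [^] k))"
    using assms by (simp add: m_assoc)
  also have "\<dots> = (s \<otimes> t) [^] Suc k \<otimes> s"
    unfolding Suc using assms nat_pow_Suc2[of "s \<otimes> t" k] by (simp add: m_assoc)
  finally show ?case .
qed (use assms in simp)

lemma word_prod_power:
  "s \<in> S \<Longrightarrow> t \<in> S \<Longrightarrow> word_prod W (concat (replicate k [s, t])) = (s \<otimes> t) [^] k"
proof (induction k)
  case (Suc k)
  then show ?case
    using nat_pow_Suc2[of "s \<otimes> t" k] by (simp add: m_assoc)
qed simp

text \<open>The reflections of the word \<open>s t s t \<dots>\<close> are \<open>(s t)\<^bsup>j\<^esup> s\<close> for \<open>j = 0, 1, \<dots>\<close>.\<close>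

lemma flips_power:
  assumes "s \<in> S" "t \<in> S" "r \<in> carrier W"
  shows "flips (concat (replicate k [s, t])) r \<longleftrightarrow>
    odd (\<Sum>j<2 * k. if r = (s \<otimes> t) [^] j \<otimes> s then 1 else 0 :: nat)"
proof (induction k)
  case (Suc k)
  let ?c = "s \<otimes> t" and ?w = "concat (replicate k [s, t])"
  have w: "?w \<in> lists S" using assms by (simp add: replicate_in_lists)
  have c: "?c \<in> carrier W" using assms by simp
  define x where "x = ?c [^] k"
  have x: "x \<in> carrier W" using c by (simp add: x_def)
  have sx: "s \<otimes> inv x = x \<otimes> s" using S_conj_pow[OF assms(1,2)] by (simp add: x_def)
  have xx: "x \<otimes> x = ?c [^] (2 * k)" using nat_pow_mult[OF c, of k k] by (simp add: x_def mult_2)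
  have "?c [^] Suc k \<otimes> ?c [^] k = ?c [^] Suc (2 * k)"
    using nat_pow_mult[OF c, of "Suc k" k] by (simp only: mult_2 add_Suc)
  then have cx: "x \<otimes> ?c \<otimes> x = ?c [^] Suc (2 * k)" by (simp add: x_def)
  \<comment> \<open>The last copy of \<open>[s, t]\<close> adds two reflections; \<open>1\<close>
    and \<open>2\<close> identify them as those with exponents \<open>2 * k\<close> and
    \<open>2 * k + 1\<close>.\<close>
  have 1: "inv x \<otimes> r \<otimes> x = s \<longleftrightarrow> r = ?c [^] (2 * k) \<otimes> s"
    using conj_eq_iff[OF x assms(3), of s] assms x by (simp add: m_assoc sx flip: xx)
  have "s \<otimes> (inv x \<otimes> r \<otimes> x) \<otimes> s = t \<longleftrightarrow> inv x \<otimes> r \<otimes> x = s \<otimes> t \<otimes> s"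
    using conj_eq_iff[of s "inv x \<otimes> r \<otimes> x" t] assms x by simp
  also have "\<dots> \<longleftrightarrow> r = x \<otimes> (s \<otimes> t \<otimes> s) \<otimes> inv x"
    using assms x by (simp add: conj_eq_iff)
  also have "x \<otimes> (s \<otimes> t \<otimes> s) \<otimes> inv x = x \<otimes> ?c \<otimes> (s \<otimes> inv x)"
    using assms x by (simp add: m_assoc)
  also have "\<dots> = ?c [^] Suc (2 * k) \<otimes> s"
    unfolding sx cx[symmetric] using assms x by (simp add: m_assoc)
  finally have 2: "s \<otimes> (inv x \<otimes> r \<otimes> x) \<otimes> s = t \<longleftrightarrow> r = ?c [^] Suc (2 * k) \<otimes> s" .
  have "concat (replicate (Suc k) [s, t]) = ?w @ [s, t]"
    by (subst replicate_Suc, subst replicate_append_same[symmetric]) simp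
  then have "flips (concat (replicate (Suc k) [s, t])) r \<longleftrightarrow>
      flips ?w r \<noteq> ((inv x \<otimes> r \<otimes> x = s) \<noteq> (s \<otimes> (inv x \<otimes> r \<otimes> x) \<otimes> s = t))"
    using flips_append[OF w assms(3)] word_prod_power[OF assms(1,2)] by (simp add: x_def)
  then show ?case
    unfolding 1 2 Suc by simp
qed simp

text \<open>As \<open>(s \<otimes> t) [^] m s t\<close> is trivial, the exponents \<open>j\<close>
  and \<open>j + m s t\<close> give the same reflection. The \<open>2 * m s t\<close> summands
  therefore pair off.\<close>

lemma flips_relator:
  assumes "s \<in> S" "t \<in> S" "r \<in> carrier W" "word_prod W (relator m s t) = \<one>"
  shows "\<not> flips (relator m s t) r"
proof -
  let ?f = "\<lambda>j. if r = (s \<otimes> t) [^] j \<otimes> s then 1 else 0 :: nat"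
  let ?k = "m s t"
  have 1: "(s \<otimes> t) [^] ?k = \<one>"
    using assms word_prod_power by (simp add: relator_def)
  have "?f (j + ?k) = ?f j" for j
    using assms 1 by (simp flip: nat_pow_mult)
  then have "(\<Sum>j<2 * ?k. ?f j) = 2 * (\<Sum>j<?k. ?f j)"
    by (simp add: mult_2 lessThan_atLeast0 sum.atLeastLessThan_concat[of 0 ?k "?k+?k", symmetric]
         sum.shift_bounds_nat_ivl[of ?f 0 ?k ?k, simplified])
  then show ?thesis
    using flips_power[OF assms(1-3)] by (simp add: relator_def)
qed

text \<open>It suffices to delete one relator. By \<open>flips_append\<close> it contributes an even
  count, and since its product is trivial, the conjugation of the letters after it is
  unchanged.\<close>

lemma flips_word_prod:
  assumes "xs \<in> lists S" "ys \<in> lists S" "word_prod W xs = word_prod W ys" "t \<in> carrier W"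
  shows "flips xs t \<longleftrightarrow> flips ys t"
proof -
  obtain m where m: "presenting_matrix m"
    by (rule presentation)
  have del: "flips as t \<longleftrightarrow> flips bs t" if step: "relator_deletion S m as bs" for as bs
  proof -
    obtain us vs a b where *: "us \<in> lists S" "a \<in> S" "b \<in> S"
        "as = us @ relator m a b @ vs" "bs = us @ vs"
      using step unfolding relator_deletion_def by (elim bexE conjE) (rule that)
    define r where "r = inv (word_prod W us) \<otimes> t \<otimes> word_prod W us"
    have r: "r \<in> carrier W" using * assms(4) by (simp add: r_def)
    show ?thesis
      using * r assms(4) relator_trivial[OF m *(2,3)] relator_in_lists[OF *(2,3), of m]
      by (simp add: flips_append flips_relator flip: r_def)
  qed
  have "equivclp (relator_deletion S m) xs ys"
    using m assms by (simp add: presenting_matrix_def)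
  then show ?thesis
    by (induction rule: equivclp_induct) (use del in auto)
qed

text \<open>The strong exchange condition. An odd count means that \<open>t\<close> occurs at some
  position; the recursion finds such a position and drops its letter.\<close>

lemma flips_exchange:
  assumes "ws \<in> lists S" "t \<in> carrier W" "flips ws t"
  shows "\<exists>ys\<in>lists S. length ys < length ws \<and> word_prod W ys = t \<otimes> word_prod W ws"
  using assms
proof (induction ws arbitrary: t)
  case (Cons s ws)
  then have s: "s \<in> S" and ws: "ws \<in> lists S" by auto
  show ?case
  proof (cases "t = s")
    case True
    then show ?thesis using s ws by (intro bexI[of _ ws]) auto
  next
    case False
    then obtain ys where ys: "ys \<in> lists S" "length ys < length ws"
        "word_prod W ys = s \<otimes> t \<otimes> s \<otimes> word_prod W ws"
      using Cons.IH[of "s \<otimes> t \<otimes> s"] Cons.prems s by auto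
    then show ?thesis
      using s ws Cons.prems by (intro bexI[of _ "s # ys"]) (auto simp: m_assoc)
  qed
qed simp


section \<open>Length and multiplication by reflections\<close>

lemma reduced_word_exists:
  assumes "w \<in> carrier W" shows "\<exists>ws. reduced_word W S w ws"
proof -
  let ?P = "\<lambda>n. \<exists>ws\<in>lists S. length ws = n \<and> word_prod W ws = w"
  obtain ws where "ws \<in> lists S" "word_prod W ws = w" using word_exists[OF assms] .
  then have "?P (length ws)" by blast
  then have "?P (len w)" unfolding cox_length_def by (rule LeastI)
  then show ?thesis unfolding reduced_word_def by blast
qed

lemma len_le: "ws \<in> lists S \<Longrightarrow> len (word_prod W ws) \<le> length ws"
  unfolding cox_length_def by (rule Least_le) auto

lemma reflections_closed: "t \<in> reflections W S \<Longrightarrow> t \<in> carrier W"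
  by (auto simp: reflections_def)

lemma reflection_square: "t \<in> reflections W S \<Longrightarrow> t \<otimes> t = \<one>"
proof -
  have "inv x \<otimes> (x \<otimes> y) = y" if "x \<in> carrier W" "y \<in> carrier W" for x y
    using that by (simp flip: m_assoc)
  then show "t \<in> reflections W S \<Longrightarrow> t \<otimes> t = \<one>"
    by (auto simp: reflections_def m_assoc)
qed

lemma S_reflection: "s \<in> S \<Longrightarrow> s \<in> reflections W S"
  unfolding reflections_def by (intro CollectI exI[of _ \<one>] exI[of _ s]) simp

lemma reflection_conj:
  assumes "t \<in> reflections W S" "s \<in> S" shows "s \<otimes> t \<otimes> s \<in> reflections W S"
proof -
  obtain x r where "x \<in> carrier W" "r \<in> S" "t = x \<otimes> r \<otimes> inv x"
    using assms by (auto simp: reflections_def)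
  then have "s \<otimes> t \<otimes> s = (s \<otimes> x) \<otimes> r \<otimes> inv (s \<otimes> x)" "s \<otimes> x \<in> carrier W"
    using assms(2) by (simp_all add: inv_mult_group m_assoc)
  then show ?thesis using \<open>r \<in> S\<close> unfolding reflections_def by blast
qed

text \<open>Use a palindrome \<open>xs @ s # rev xs\<close>. The word \<open>xs @ rev xs\<close> has
  trivial product, so the contributions of the two outer parts cancel, and the middle letter
  remains.\<close>

lemma flips_reflection:
  assumes "t \<in> reflections W S"
  obtains ts where "ts \<in> lists S" "word_prod W ts = t" "flips ts t"
proof -
  obtain x s where x: "x \<in> carrier W" and s: "s \<in> S" and t: "t = x \<otimes> s \<otimes> inv x"
    using assms by (auto simp: reflections_def)
  obtain xs where xs: "xs \<in> lists S" "word_prod W xs = x"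
    using word_exists[OF x] .
  have rxs: "rev xs \<in> lists S" using xs by auto
  have tc: "t \<in> carrier W" using x s t by simp
  have c: "inv x \<otimes> t \<otimes> x = s" using x s tc t by (simp add: conj_eq_iff)
  have "word_prod W (xs @ rev xs) = word_prod W []"
    using xs rxs x by (simp add: word_prod_append word_prod_rev)
  then have "\<not> flips (xs @ rev xs) t"
    using flips_word_prod[of "xs @ rev xs" "[]" t] xs rxs tc by simp
  then have "flips xs t = flips (rev xs) s"
    using xs tc c by (simp add: flips_append)
  then have "flips (xs @ s # rev xs) t"
    using xs tc c s by (simp add: flips_append)
  moreover have "word_prod W (xs @ s # rev xs) = t"
    using xs rxs s x t word_prod_append[of xs "s # rev xs"] by (simp add: word_prod_rev m_assoc)
  moreover have "xs @ s # rev xs \<in> lists S" using xs rxs s by simp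
  ultimately show thesis using that by blast
qed

lemma len_reflection_less:
  assumes "t \<in> reflections W S" "ws \<in> lists S" "flips ws t"
  shows "len (t \<otimes> word_prod W ws) < len (word_prod W ws)"
proof -
  obtain rs where rs: "reduced_word W S (word_prod W ws) rs"
    using reduced_word_exists word_prod_closed[OF assms(2)] by blast
  then have "flips rs t"
    using flips_word_prod[of rs ws t] assms by (simp add: reduced_word_def reflections_closed)
  then obtain ys where "ys \<in> lists S" "length ys < length rs" "word_prod W ys = t \<otimes> word_prod W rs"
    using flips_exchange[of rs t] assms rs by (auto simp: reduced_word_def reflections_closed)
  then show ?thesis
    using rs len_le[of ys] by (simp add: reduced_word_def)
qed

text \<open>Prefixing a word for \<open>t\<close> that flips \<open>t\<close> changes the parity at
  \<open>t\<close>, because \<open>t\<close> commutes with itself. Then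
  \<open>len_reflection_less\<close> applies to \<open>t \<otimes> word_prod W ws\<close>.\<close>

lemma len_reflection_greater:
  assumes "t \<in> reflections W S" "ws \<in> lists S" "\<not> flips ws t"
  shows "len (word_prod W ws) < len (t \<otimes> word_prod W ws)"
proof -
  obtain ts where ts: "ts \<in> lists S" "word_prod W ts = t" "flips ts t"
    using flips_reflection[OF assms(1)] .
  have t: "t \<in> carrier W" "t \<otimes> t = \<one>"
    using assms(1) by (simp_all add: reflections_closed reflection_square)
  then have "inv t \<otimes> t \<otimes> t = t" by simp
  then have "flips (ts @ ws) t"
    using assms ts t by (simp add: flips_append)
  then have "len (t \<otimes> word_prod W (ts @ ws)) < len (word_prod W (ts @ ws))"
    using assms ts by (intro len_reflection_less) auto
  then show ?thesis
    using assms ts t by (simp add: word_prod_append flip: m_assoc)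
qed

lemma len_S_cases:
  assumes "s \<in> S" "w \<in> carrier W"
  obtains "len w < len (s \<otimes> w)" | "len (s \<otimes> w) < len w"
  using assms len_reflection_less[OF S_reflection] len_reflection_greater[OF S_reflection]
  by (metis word_exists)

section \<open>Lifting in the Bruhat order\<close>

lemma bruhat_step_closed: "bruhat_step W S u v \<Longrightarrow> u \<in> carrier W \<Longrightarrow> v \<in> carrier W"
  by (auto simp: bruhat_step_def reflections_closed)

lemma bruhat_refl [simp]: "w \<in> carrier W \<Longrightarrow> w \<preceq> w"
  by (simp add: bruhat_le_def)

lemma bruhat_trans [trans]: "u \<preceq> v \<Longrightarrow> v \<preceq> w \<Longrightarrow> u \<preceq> w"
  by (auto simp: bruhat_le_def)

lemma bruhat_step_le: "bruhat_step W S u v \<Longrightarrow> u \<in> carrier W \<Longrightarrow> u \<preceq> v"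
  by (simp add: bruhat_le_def bruhat_step_closed r_into_rtranclp)

lemma bruhat_closed: "u \<preceq> v \<Longrightarrow> u \<in> carrier W" "u \<preceq> v \<Longrightarrow> v \<in> carrier W"
  by (auto simp: bruhat_le_def)

lemma bruhat_len: assumes "u \<preceq> v" shows "u = v \<or> len u < len v"
proof -
  have "(bruhat_step W S)\<^sup>*\<^sup>* u v" using assms by (simp add: bruhat_le_def)
  then show ?thesis
    by induction (auto simp: bruhat_step_def)
qed

lemma bruhat_antisym: "u \<preceq> v \<Longrightarrow> v \<preceq> u \<Longrightarrow> u = v"
  by (metis bruhat_len less_asym)

lemma bruhat_S:
  assumes "s \<in> S" "w \<in> carrier W"
  shows "len w < len (s \<otimes> w) \<Longrightarrow> w \<preceq> s \<otimes> w" "len (s \<otimes> w) < len w \<Longrightarrow> s \<otimes> w \<preceq> w"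
proof -
  show "w \<preceq> s \<otimes> w" if "len w < len (s \<otimes> w)"
    using that assms S_reflection by (intro bruhat_step_le) (auto simp: bruhat_step_def)
  show "s \<otimes> w \<preceq> w" if "len (s \<otimes> w) < len w"
    using that assms S_reflection
    by (intro bruhat_step_le) (auto simp: bruhat_step_def intro!: bexI[of _ s])
qed

text \<open>If \<open>t\<close> is the reflection of the given step, then
  \<open>s \<otimes> t \<otimes> s\<close> is that of the new one. It differs from \<open>s\<close>
  because \<open>v \<noteq> s \<otimes> u\<close>, so the additional letter \<open>s\<close> does
  not affect its parity.\<close>

lemma bruhat_step_lift:
  assumes "bruhat_step W S u v" "u \<in> carrier W" "s \<in> S" "v \<noteq> s \<otimes> u"
  shows "bruhat_step W S (s \<otimes> u) (s \<otimes> v)"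
proof -
  obtain t where t: "t \<in> reflections W S" "v = t \<otimes> u" and less: "len u < len v"
    using assms by (auto simp: bruhat_step_def)
  have tc: "t \<in> carrier W" using t by (simp add: reflections_closed)
  have v: "v \<in> carrier W" using t tc assms by simp
  obtain ws where ws: "ws \<in> lists S" "word_prod W ws = v" using word_exists[OF v] .
  have tv: "t \<otimes> v = u"
    using t tc assms by (simp add: reflection_square flip: m_assoc)
  have "flips ws t"
    using len_reflection_greater[OF t(1) ws(1)] ws tv less by auto
  moreover have "s \<otimes> t \<otimes> s \<noteq> s"
  proof
    assume "s \<otimes> t \<otimes> s = s"
    then have "t = s" using assms(3) tc by (metis S_cancel S_cancel_right S_closed S_square m_closed r_one)
    then show False using t assms by simp
  qed
  moreover have "s \<otimes> (s \<otimes> t \<otimes> s) \<otimes> s = t"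
    using assms tc by (simp add: m_assoc)
  ultimately have "flips (s # ws) (s \<otimes> t \<otimes> s)" by simp
  then have "len ((s \<otimes> t \<otimes> s) \<otimes> (s \<otimes> v)) < len (s \<otimes> v)"
    using len_reflection_less[OF reflection_conj[OF t(1) assms(3)], of "s # ws"] ws assms by simp
  moreover have "(s \<otimes> t \<otimes> s) \<otimes> (s \<otimes> v) = s \<otimes> u"
    using assms tc v tv by (simp add: m_assoc)
  moreover have "(s \<otimes> t \<otimes> s) \<otimes> (s \<otimes> u) = s \<otimes> v"
    using assms tc t by (simp add: m_assoc)
  ultimately show ?thesis
    unfolding bruhat_step_def using reflection_conj[OF t(1) assms(3)] by metis
qed

section \<open>Demazure products\<close>

text \<open>This is left multiplication by a generator in the 0-Hecke monoid, and \<open>dem\<close>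
  is the Demazure product of a word.\<close>

definition up :: "'a \<Rightarrow> 'a \<Rightarrow> 'a" where
  "up s w = (if len w < len (s \<otimes> w) then s \<otimes> w else w)"

abbreviation dem :: "'a list \<Rightarrow> 'a" where "dem ws \<equiv> foldr up ws \<one>"

lemma up_closed [simp]: "s \<in> S \<Longrightarrow> w \<in> carrier W \<Longrightarrow> up s w \<in> carrier W"
  by (simp add: up_def)

lemma foldr_up_closed [simp]: "ws \<in> lists S \<Longrightarrow> w \<in> carrier W \<Longrightarrow> foldr up ws w \<in> carrier W"
  by (induction ws) auto

lemma pi_gen_closed [simp]: "s \<in> S \<Longrightarrow> w \<in> carrier W \<Longrightarrow> pi_gen W S s w \<in> carrier W"
  by (simp add: pi_gen_def)

lemma up_pi_gen_cases:
  assumes "s \<in> S" "w \<in> carrier W"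
  obtains "len w < len (s \<otimes> w)" "up s w = s \<otimes> w" "pi_gen W S s w = w" "w \<preceq> s \<otimes> w"
  | "len (s \<otimes> w) < len w" "up s w = w" "pi_gen W S s w = s \<otimes> w" "s \<otimes> w \<preceq> w"
  by (rule len_S_cases[OF assms])
    (use that in \<open>auto simp: up_def pi_gen_def bruhat_S assms\<close>)

text \<open>Unless \<open>v = s \<otimes> u\<close>, the step lifts to
  \<open>s \<otimes> u \<preceq> s \<otimes> v\<close>. Together with \<open>u \<preceq> v\<close>
  this settles all four combinations of ascents and descents by transitivity.\<close>

lemma up_pi_gen_step:
  assumes s: "s \<in> S" and u: "u \<in> carrier W" and step: "bruhat_step W S u v"
  shows "up s u \<preceq> up s v \<and> pi_gen W S s u \<preceq> pi_gen W S s v"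
proof -
  have v: "v \<in> carrier W" and le: "u \<preceq> v"
    using bruhat_step_closed[OF step u] bruhat_step_le[OF step u] .
  show ?thesis
  proof (cases "v = s \<otimes> u")
    case True
    then have "len u < len (s \<otimes> u)" using step by (auto simp: bruhat_step_def)
    then show ?thesis
      using True s u by (auto simp: up_def pi_gen_def)
  next
    case False
    have le': "s \<otimes> u \<preceq> s \<otimes> v"
      using bruhat_step_lift[OF step u s False] s u by (simp add: bruhat_step_le)
    show ?thesis
      by (rule up_pi_gen_cases[OF s u]; rule up_pi_gen_cases[OF s v])
        (use le le' in \<open>auto intro: bruhat_trans\<close>)
  qed
qed

lemma up_pi_gen_mono:
  assumes "s \<in> S" "u \<preceq> v"
  shows "up s u \<preceq> up s v" "pi_gen W S s u \<preceq> pi_gen W S s v"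
proof -
  have u: "u \<in> carrier W" and "(bruhat_step W S)\<^sup>*\<^sup>* u v" using assms by (simp_all add: bruhat_le_def)
  from this(2) have "v \<in> carrier W \<and> up s u \<preceq> up s v \<and> pi_gen W S s u \<preceq> pi_gen W S s v"
  proof induction
    case base
    then show ?case using u assms by simp
  next
    case (step v w)
    then show ?case
      using up_pi_gen_step[OF assms(1), of v w] bruhat_step_closed[of v w] bruhat_trans by blast
  qed
  then show "up s u \<preceq> up s v" "pi_gen W S s u \<preceq> pi_gen W S s v" by simp_all
qed

lemma le_up: "s \<in> S \<Longrightarrow> w \<in> carrier W \<Longrightarrow> w \<preceq> up s w"
  by (metis bruhat_refl up_pi_gen_cases)

text \<open>A Galois connection: both operators are monotone, and
  \<open>x \<preceq> up s (pi_gen W S s x)\<close> and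
  \<open>pi_gen W S s (up s w) \<preceq> w\<close> are its unit and counit.\<close>

lemma pi_gen_le_iff:
  assumes s: "s \<in> S" and x: "x \<in> carrier W" and w: "w \<in> carrier W"
  shows "pi_gen W S s x \<preceq> w \<longleftrightarrow> x \<preceq> up s w"
proof
  have "x \<preceq> up s (pi_gen W S s x)"
    using s x by (auto simp: up_def pi_gen_def bruhat_S)
  then show "x \<preceq> up s w" if "pi_gen W S s x \<preceq> w"
    using up_pi_gen_mono(1)[OF s that] bruhat_trans by blast
  have "pi_gen W S s (up s w) \<preceq> w"
    using s w by (rule up_pi_gen_cases) (use s w in \<open>auto simp: up_def pi_gen_def\<close>)
  then show "pi_gen W S s x \<preceq> w" if "x \<preceq> up s w"
    using up_pi_gen_mono(2)[OF s that] bruhat_trans by blast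
qed

lemma foldr_pi_gen_closed: "ws \<in> lists S \<Longrightarrow> w \<in> carrier W \<Longrightarrow> foldr (pi_gen W S) ws w \<in> carrier W"
  by (induction ws) auto

text \<open>The word is reversed because the adjoint of a composition composes the adjoints in the
  opposite order.\<close>

lemma foldr_pi_gen_le_iff:
  "ws \<in> lists S \<Longrightarrow> x \<in> carrier W \<Longrightarrow> w \<in> carrier W \<Longrightarrow>
   foldr (pi_gen W S) ws x \<preceq> w \<longleftrightarrow> x \<preceq> foldr up (rev ws) w"
  by (induction ws arbitrary: w) (auto simp: pi_gen_le_iff foldr_pi_gen_closed)

section \<open>Subwords and the Demazure product\<close>

lemma word_prod_le_dem:
  "subseq xs ws \<Longrightarrow> ws \<in> lists S \<Longrightarrow> word_prod W xs \<preceq> dem ws"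
proof (induction rule: list_emb.induct)
  case (list_emb_Nil ws)
  then show ?case
  proof (induction ws)
    case (Cons s ws)
    then show ?case using bruhat_trans[OF _ le_up[of s "dem ws"]] by simp
  qed simp
next
  case (list_emb_Cons xs ws s)
  then show ?case using bruhat_trans[OF _ le_up[of s "dem ws"]] by simp
next
  case (list_emb_Cons2 a s xs ws)
  then have s: "s \<in> S" and le: "word_prod W xs \<preceq> dem ws" and "a = s" by auto
  have "word_prod W xs \<in> carrier W" using le bruhat_closed by blast
  then have "s \<otimes> word_prod W xs \<preceq> up s (word_prod W xs)"
    by (rule up_pi_gen_cases[OF s]) (use s \<open>word_prod W xs \<in> carrier W\<close> in auto)
  also have "\<dots> \<preceq> up s (dem ws)" using up_pi_gen_mono(1)[OF s le] .
  finally show ?case using \<open>a = s\<close> by simp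
qed

lemma len_one: "len \<one> = 0"
  using len_le[of "[]"] by simp

text \<open>By adjunction, \<open>x \<preceq> up s (dem ws)\<close> becomes
  \<open>pi_gen W S s x \<preceq> dem ws\<close>. The letter \<open>s\<close> is used exactly when
  it shortens \<open>x\<close>, which keeps the chosen subword reduced.\<close>

lemma subword_property:
  "ws \<in> lists S \<Longrightarrow> x \<preceq> dem ws \<Longrightarrow> \<exists>xs. reduced_word W S x xs \<and> subseq xs ws"
proof (induction ws arbitrary: x)
  case Nil
  then have "x = \<one>" using bruhat_len[of x \<one>] by (auto simp: len_one)
  then show ?case by (auto simp: reduced_word_def len_one)
next
  case (Cons s ws)
  then have s: "s \<in> S" and ws: "ws \<in> lists S" and x: "x \<in> carrier W"
    using bruhat_closed by auto
  have "pi_gen W S s x \<preceq> dem ws"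
    using Cons.prems s ws x by (simp add: pi_gen_le_iff)
  then obtain ys where ys: "reduced_word W S (pi_gen W S s x) ys" "subseq ys ws"
    using Cons.IH ws by blast
  show ?case
  proof (cases "len (s \<otimes> x) < len x")
    case True
    then have y: "word_prod W ys = s \<otimes> x" "ys \<in> lists S" "length ys = len (s \<otimes> x)"
      using ys by (auto simp: pi_gen_def reduced_word_def)
    then have "word_prod W (s # ys) = x" using s x by simp
    moreover have "length (s # ys) = len x"
      using True y len_le[of "s # ys"] calculation s by simp
    ultimately have "reduced_word W S x (s # ys)"
      using y s by (simp add: reduced_word_def)
    then show ?thesis using ys(2) by (intro exI[of _ "s # ys"]) simp
  next
    case False
    then show ?thesis using ys by (auto simp: pi_gen_def)
  qed
qed

text \<open>By the subword property, \<open>dem xs\<close> is the ordinary product of a subword of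
  \<open>xs\<close>, hence of one of \<open>ws\<close>.\<close>

lemma dem_subseq:
  assumes "subseq xs ws" "ws \<in> lists S" shows "dem xs \<preceq> dem ws"
proof -
  have xs: "xs \<in> lists S" using assms by (auto simp: subseq_conv_nths dest: in_set_nthsD)
  then obtain ys where "reduced_word W S (dem xs) ys" "subseq ys xs"
    using subword_property[OF xs bruhat_refl] by auto
  then show ?thesis
    using word_prod_le_dem[of ys ws] assms subseq_order.order_trans by (auto simp: reduced_word_def)
qed

text \<open>The Demazure product lies above \<open>w\<close>, but has a reduced word inside
  \<open>ws\<close> and so is no longer than \<open>w\<close>.\<close>

lemma dem_reduced_word:
  assumes "reduced_word W S w ws" shows "dem ws = w"
proof -
  have ws: "ws \<in> lists S" "word_prod W ws = w" "length ws = len w"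
    using assms by (auto simp: reduced_word_def)
  then have "w \<preceq> dem ws" using word_prod_le_dem[of ws ws] by simp
  moreover obtain xs where "reduced_word W S (dem ws) xs" "subseq xs ws"
    using subword_property[of ws "dem ws"] ws by auto
  then have "len (dem ws) \<le> len w"
    using ws list_emb_length[of "(=)" xs ws] by (auto simp: reduced_word_def)
  ultimately show ?thesis using bruhat_len[of w "dem ws"] by auto
qed

text \<open>A reduced subword for the left side splits into a part in \<open>as\<close> and a part
  in \<open>cs\<close>. The product of the first part lies below \<open>dem as = dem bs\<close>, so
  a subword of \<open>bs\<close> can replace it.\<close>

lemma dem_append_le:
  assumes "as \<in> lists S" "bs \<in> lists S" "cs \<in> lists S" "dem as = dem bs"
  shows "dem (as @ cs) \<preceq> dem (bs @ cs)"
proof -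
  have l: "as @ cs \<in> lists S" using assms by simp
  then have "dem (as @ cs) \<preceq> dem (as @ cs)" by (intro bruhat_refl foldr_up_closed) auto
  then obtain zs where zs: "reduced_word W S (dem (as @ cs)) zs" "subseq zs (as @ cs)"
    using subword_property[OF l] by blast
  obtain xs ys where xy: "zs = xs @ ys" "subseq xs as" "subseq ys cs"
    using zs(2) by (auto simp: subseq_append_iff)
  have l': "xs \<in> lists S" "ys \<in> lists S" using zs xy by (auto simp: reduced_word_def)
  have "word_prod W xs \<preceq> dem bs"
    using word_prod_le_dem[OF xy(2) assms(1)] assms(4) by simp
  then obtain xs' where xs': "reduced_word W S (word_prod W xs) xs'" "subseq xs' bs"
    using subword_property[OF assms(2)] by blast
  have "word_prod W (xs' @ ys) \<preceq> dem (bs @ cs)"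
    using xs' xy assms by (intro word_prod_le_dem list_emb_append_mono) auto
  moreover have "word_prod W (xs' @ ys) = dem (as @ cs)"
    using xs' zs xy l' by (simp add: reduced_word_def word_prod_append)
  ultimately show ?thesis by simp
qed

text \<open>Write \<open>w\<close> as the Demazure product of one of its reduced words and append
  that word to \<open>as\<close> and \<open>bs\<close>.\<close>

lemma foldr_up_cong:
  assumes "as \<in> lists S" "bs \<in> lists S" "dem as = dem bs" "w \<in> carrier W"
  shows "foldr up as w = foldr up bs w"
proof -
  obtain cs where cs: "reduced_word W S w cs" using reduced_word_exists assms(4) by blast
  then have "cs \<in> lists S" "dem cs = w" by (simp_all add: reduced_word_def dem_reduced_word)
  then show ?thesis
    using dem_append_le[of as bs cs] dem_append_le[of bs as cs] assms bruhat_antisym by simp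
qed

section \<open>Filters of the Bruhat order\<close>

text \<open>For a filter \<open>F\<close> this is \<open>\<tau>\<^sub>s \<dots> \<tau>\<^sub>t F\<close> where \<open>as = [t, \<dots>, s]\<close>.\<close>

definition pull :: "'a list \<Rightarrow> 'a set \<Rightarrow> 'a set" where
  "pull as F = {w \<in> carrier W. foldr up as w \<in> F}"

lemma pull_Cons: "as \<in> lists S \<Longrightarrow> pull (s # as) F = pull as (pull [s] F)"
  using foldr_up_closed by (fastforce simp: pull_def)

lemma order_filterD: "order_filter W S F \<Longrightarrow> x \<in> F \<Longrightarrow> x \<preceq> y \<Longrightarrow> y \<in> F"
  using bruhat_closed by (auto simp: order_filter_def)

lemma order_filter_closed: "order_filter W S F \<Longrightarrow> x \<in> F \<Longrightarrow> x \<in> carrier W"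
  by (auto simp: order_filter_def)

text \<open>\<open>ws\<close> is the word chosen in \<open>pi_elt\<close>. After the adjunction, the
  condition asks for an element of \<open>F\<close> below \<open>foldr up (rev ws) w\<close>, which
  for a filter means membership.\<close>

lemma tau_eq_pull:
  assumes F: "order_filter W S F" and u: "u \<in> carrier W"
  obtains ws where "reduced_word W S u ws" "tau W S u F = pull (rev ws) F"
proof
  define ws where "ws = (SOME ws. reduced_word W S u ws)"
  show ws: "reduced_word W S u ws"
    unfolding ws_def using reduced_word_exists[OF u] by (rule someI_ex)
  then have l: "ws \<in> lists S" by (simp add: reduced_word_def)
  have "tau W S u F = {w \<in> carrier W. \<exists>x\<in>F. foldr (pi_gen W S) ws x \<preceq> w}"
    by (simp add: tau_def pi_elt_def ws_def)
  also have "\<dots> = {w \<in> carrier W. \<exists>x\<in>F. x \<preceq> foldr up (rev ws) w}"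
    using foldr_pi_gen_le_iff[OF l] order_filter_closed[OF F] by auto
  also have "\<dots> = pull (rev ws) F"
    unfolding pull_def using order_filterD[OF F] order_filter_closed[OF F] bruhat_refl by blast
  finally show "tau W S u F = pull (rev ws) F" .
qed

lemma reduced_word_rev:
  assumes "reduced_word W S u ws" shows "reduced_word W S (inv u) (rev ws)"
proof -
  have ws: "ws \<in> lists S" "word_prod W ws = u" "length ws = len u" "rev ws \<in> lists S"
    using assms by (auto simp: reduced_word_def)
  have u: "u \<in> carrier W" using ws(2) word_prod_closed[OF ws(1)] by simp
  have p: "word_prod W (rev ws) = inv u" using ws by (simp add: word_prod_rev)
  obtain vs where vs: "reduced_word W S (inv u) vs" using reduced_word_exists u by blast
  then have v: "vs \<in> lists S" "word_prod W vs = inv u" "length vs = len (inv u)" "rev vs \<in> lists S"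
    by (auto simp: reduced_word_def)
  then have "len u \<le> len (inv u)" using len_le[of "rev vs"] u by (simp add: word_prod_rev)
  then show ?thesis using ws p len_le[of "rev ws"] by (simp add: reduced_word_def)
qed

text \<open>Here \<open>as\<close> may be non-reduced. The witness is the inverse of
  \<open>dem as\<close>, since \<open>tau\<close> reads a reduced word backwards;
  \<open>foldr_up_cong\<close> then replaces that word by \<open>as\<close>.\<close>

lemma left_le_pull:
  assumes F: "order_filter W S F" and as: "as \<in> lists S"
  shows "left_le W S (pull as F) F"
proof -
  have d: "dem as \<in> carrier W" using as by simp
  obtain ws where ws: "reduced_word W S (inv (dem as)) ws" "tau W S (inv (dem as)) F = pull (rev ws) F"
    using tau_eq_pull[OF F, of "inv (dem as)"] d by auto
  have "dem (rev ws) = dem as"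
    using dem_reduced_word[OF reduced_word_rev[OF ws(1)]] d by simp
  moreover have "rev ws \<in> lists S" using ws by (auto simp: reduced_word_def)
  ultimately have "pull (rev ws) F = pull as F"
    unfolding pull_def using foldr_up_cong[of "rev ws" as] as by auto
  then show ?thesis
    unfolding left_le_def using ws d by (metis inv_closed)
qed

section \<open>Pulled filters in the MacNeille completion\<close>

lemma Mac_order_filter: "F \<in> Mac W S \<Longrightarrow> order_filter W S F"
  unfolding Mac_def by blast

lemma pull_Nil: "order_filter W S F \<Longrightarrow> pull [] F = F"
  by (auto simp: pull_def order_filter_closed)

text \<open>The identity U L U = U for upper and lower bounds.\<close>

lemma upper_bounds_Mac:
  assumes "A \<subseteq> carrier W" shows "upper_bounds W S A \<in> Mac W S"
  unfolding Mac_def order_filter_def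
proof (intro CollectI conjI ballI impI)
  show "upper_bounds W S A = upper_bounds W S (lower_bounds W S (upper_bounds W S A))"
    using assms by (auto simp: upper_bounds_def lower_bounds_def)
qed (auto simp: upper_bounds_def intro: bruhat_trans)

text \<open>By adjunction, \<open>up s w\<close> bounds the set L(F) from above iff \<open>w\<close>
  bounds its image under \<open>pi_gen W S s\<close>, so the pulled filter is again a set of upper
  bounds.\<close>

lemma pull_Mac_S:
  assumes "F \<in> Mac W S" "s \<in> S" shows "pull [s] F \<in> Mac W S"
proof -
  let ?L = "lower_bounds W S F"
  have L: "?L \<subseteq> carrier W" by (auto simp: lower_bounds_def)
  have F: "F = upper_bounds W S ?L" using assms(1) unfolding Mac_def by blast
  have "w \<in> pull [s] F \<longleftrightarrow> w \<in> upper_bounds W S (pi_gen W S s ` ?L)" for w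
  proof -
    have "up s w \<in> F \<longleftrightarrow> (\<forall>x\<in>?L. x \<preceq> up s w)" if "w \<in> carrier W"
      using that assms(2) arg_cong[OF F, of "\<lambda>A. up s w \<in> A"] by (simp add: upper_bounds_def)
    moreover have "x \<preceq> up s w \<longleftrightarrow> pi_gen W S s x \<preceq> w" if "w \<in> carrier W" "x \<in> ?L" for x
      using that assms(2) L by (simp add: pi_gen_le_iff subset_eq)
    ultimately show ?thesis by (auto simp: pull_def upper_bounds_def)
  qed
  then have "pull [s] F = upper_bounds W S (pi_gen W S s ` ?L)" by blast
  moreover have "pi_gen W S s ` ?L \<subseteq> carrier W" using L assms by auto
  ultimately show ?thesis using upper_bounds_Mac by simp
qed

lemma pull_Mac: "as \<in> lists S \<Longrightarrow> F \<in> Mac W S \<Longrightarrow> pull as F \<in> Mac W S"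
proof (induction as arbitrary: F)
  case Nil
  then show ?case by (simp add: pull_Nil Mac_order_filter)
next
  case (Cons s as)
  then show ?case using pull_Mac_S[of F s] by (simp add: pull_Cons[of as s F])
qed

text \<open>An element of least length among those of \<open>F\<close> below \<open>x\<close> is
  minimal, because length strictly increases along the Bruhat order.\<close>

lemma min_element_below:
  assumes F: "order_filter W S F" and x: "x \<in> F"
  obtains w where "w \<in> min_elements W S F" "w \<preceq> x"
proof -
  let ?P = "\<lambda>y. y \<in> F \<and> y \<preceq> x"
  have P: "?P x" using x order_filter_closed[OF F] by auto
  define w where "w = arg_min len ?P"
  have w: "w \<in> F" "w \<preceq> x" and least: "\<And>y. ?P y \<Longrightarrow> len w \<le> len y"
    using arg_min_nat_lemma[of ?P x len, OF P] unfolding w_def by auto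
  have "w \<in> min_elements W S F"
    unfolding min_elements_def
  proof (intro CollectI conjI ballI impI)
    fix y assume y: "y \<in> F" "y \<preceq> w"
    then have "len w \<le> len y" using least w(2) bruhat_trans by blast
    then show "y = w" using bruhat_len[OF y(2)] by auto
  qed (rule w(1))
  then show thesis using w that by blast
qed

section \<open>Purity of a filter and of its pulls\<close>

definition pure_filter :: "'a set \<Rightarrow> bool" where
  "pure_filter F \<longleftrightarrow>
     (\<forall>x\<in>min_elements W S F. \<forall>y\<in>min_elements W S F. len x = len y)"

text \<open>Quantifying over all words, reduced or not, makes closure under \<open>pull [s]\<close>
  a matter of prefixing a letter.\<close>

definition hereditarily_pure :: "'a set \<Rightarrow> bool" where
  "hereditarily_pure F \<longleftrightarrow> F \<in> Mac W S \<and> (\<forall>as\<in>lists S. pure_filter (pull as F))"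

lemma hereditarily_pure_imp_pure:
  assumes "hereditarily_pure F" shows "pure_filter F"
proof -
  have "pull [] F = F"
    using assms by (simp add: hereditarily_pure_def pull_Nil Mac_order_filter)
  then show ?thesis using assms unfolding hereditarily_pure_def by (metis lists.Nil)
qed

lemma hereditarily_pure_pull:
  "hereditarily_pure F \<Longrightarrow> s \<in> S \<Longrightarrow> hereditarily_pure (pull [s] F)"
  unfolding hereditarily_pure_def
  using pull_Cons[of _ s F] by (metis Cons_in_lists_iff pull_Mac_S)


section \<open>Faces and Demazure products\<close>

definition face_complex :: "int set \<Rightarrow> (int \<Rightarrow> 'a) \<Rightarrow> 'a set \<Rightarrow> int set set" where
  "face_complex V Q F = {D. D \<subseteq> V \<and> dem (restricted_word Q (V - D)) \<in> F}"

lemma restricted_word_in_lists: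
  "finite V \<Longrightarrow> Q \<in> V \<rightarrow> S \<Longrightarrow> restricted_word Q (V - D) \<in> lists S"
  by (auto simp: restricted_word_def)

text \<open>A minimal element spelled by a subword lies below the Demazure product. Conversely, the
  subword property spells any minimal element below that product.\<close>

lemma filter_subword_complex_eq:
  assumes F: "order_filter W S F" and V: "finite V" "Q \<in> V \<rightarrow> S"
  shows "filter_subword_complex W S V Q F = face_complex V Q F"
proof (intro Set.set_eqI iffI)
  fix D
  let ?R = "restricted_word Q (V - D)"
  note R = restricted_word_in_lists[OF V, of D]
  show "D \<in> face_complex V Q F" if D: "D \<in> filter_subword_complex W S V Q F"
  proof -
    obtain w ws where w: "w \<in> min_elements W S F" "D \<subseteq> V" "reduced_word W S w ws" "subseq ws ?R"
      using D by (auto simp: filter_subword_complex_def subword_complex_def)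
    then have "w \<preceq> dem ?R" using word_prod_le_dem[OF w(4) R] by (simp add: reduced_word_def)
    then show ?thesis
      using w order_filterD[OF F, of w] by (simp add: face_complex_def min_elements_def)
  qed
  show "D \<in> filter_subword_complex W S V Q F" if "D \<in> face_complex V Q F"
  proof -
    have D: "D \<subseteq> V" "dem ?R \<in> F" using that by (simp_all add: face_complex_def)
    obtain w where "w \<in> min_elements W S F" "w \<preceq> dem ?R"
      using min_element_below[OF F D(2)] .
    then show ?thesis
      using subword_property[OF R] D(1)
      unfolding filter_subword_complex_def subword_complex_def by blast
  qed
qed

lemma face_complex_mono:
  assumes F: "order_filter W S F" and V: "finite V" "Q \<in> V \<rightarrow> S"
    and "D \<in> face_complex V Q F" "E \<subseteq> D"
  shows "E \<in> face_complex V Q F"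
proof -
  have "subseq (restricted_word Q (V - D)) (restricted_word Q (V - E))"
    using V assms(5) by (intro subseq_restricted_word) auto
  then have "dem (restricted_word Q (V - D)) \<preceq> dem (restricted_word Q (V - E))"
    using dem_subseq restricted_word_in_lists[OF V] by blast
  then show ?thesis
    using assms order_filterD[OF F] by (auto simp: face_complex_def)
qed

text \<open>The complement of \<open>D\<close> contains a reduced word of a minimal element
  \<open>w\<close>. Removing all positions outside that word gives a face containing
  \<open>D\<close>, hence \<open>D\<close> itself.\<close>

lemma facet_word_length:
  assumes F: "order_filter W S F" and V: "finite V" "Q \<in> V \<rightarrow> S"
    and D: "D \<in> facets (face_complex V Q F)"
  shows "\<exists>w\<in>min_elements W S F. len w = card (V - D)"
proof -
  have D': "D \<subseteq> V" "dem (restricted_word Q (V - D)) \<in> F"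
    using D by (auto simp: facets_def face_complex_def)
  obtain w where w: "w \<in> min_elements W S F" "w \<preceq> dem (restricted_word Q (V - D))"
    using min_element_below[OF F D'(2)] .
  then obtain ws where ws: "reduced_word W S w ws" "subseq ws (restricted_word Q (V - D))"
    using subword_property restricted_word_in_lists[OF V] by blast
  obtain E where E: "E \<subseteq> V - D" "restricted_word Q E = ws"
    using subseq_restricted_wordE[OF ws(2)] V by blast
  have "V - (V - E) = E" using E by auto
  then have "V - E \<in> face_complex V Q F"
    using E w dem_reduced_word[OF ws(1)] by (simp add: face_complex_def min_elements_def)
  then have "V - E = D" using D E D' unfolding facets_def by auto
  then have "V - D = E" using E by auto
  then have "len w = card (V - D)"
    using ws E by (auto simp: reduced_word_def restricted_word_def)
  then show ?thesis using w by blast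
qed

section \<open>Deletion and link of the first position\<close>

context
  fixes V :: "int set" and v :: int and Q :: "int \<Rightarrow> 'a" and F :: "'a set"
  assumes V: "finite V" "\<And>a. a \<in> V \<Longrightarrow> v < a" and Q: "Q \<in> insert v V \<rightarrow> S"
    and F: "order_filter W S F"
begin

lemma min_not_in: "v \<notin> V" using V by blast

lemma letters_in_S: "Q v \<in> S" "Q \<in> V \<rightarrow> S" using Q by auto

lemma face_complex_insert_iff:
  "D \<in> face_complex (insert v V) Q F \<longleftrightarrow>
     (if v \<in> D then D - {v} \<in> face_complex V Q F else D \<in> face_complex V Q (pull [Q v] F))"
proof (cases "v \<in> D")
  case True
  then have "insert v V - D = V - (D - {v})" using min_not_in by auto
  then show ?thesis using True by (auto simp: face_complex_def)
next
  case False
  then have "insert v V - D = insert v (V - D)" by auto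
  then have "restricted_word Q (insert v V - D) = Q v # restricted_word Q (V - D)"
    using restricted_word_insert[of "V - D" v Q] V by simp
  moreover have "dem (restricted_word Q (V - D)) \<in> carrier W"
    using restricted_word_in_lists[OF V(1) letters_in_S(2)] by (intro foldr_up_closed) auto
  ultimately show ?thesis using False by (auto simp: face_complex_def pull_def)
qed

lemma face_complex_subset: "D \<in> face_complex V Q G \<Longrightarrow> v \<notin> D"
  using min_not_in by (auto simp: face_complex_def)

lemma subset_pull: "F \<subseteq> pull [Q v] F"
  using order_filter_closed[OF F] order_filterD[OF F] le_up[OF letters_in_S(1)] by (auto simp: pull_def)

lemma deletion_face_complex:
  "deletion v (face_complex (insert v V) Q F) = face_complex V Q (pull [Q v] F)"
  by (auto simp: deletion_def face_complex_insert_iff face_complex_subset)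

lemma link_face_complex: "link v (face_complex (insert v V) Q F) = face_complex V Q F"
proof -
  have "face_complex V Q F \<subseteq> face_complex V Q (pull [Q v] F)"
    using subset_pull by (auto simp: face_complex_def)
  then show ?thesis
    by (auto simp: link_def deletion_face_complex face_complex_insert_iff face_complex_subset)
qed

lemma facets_deletion_face_complex:
  assumes pure: "pure_filter F" "pure_filter (pull [Q v] F)"
    and pull: "order_filter W S (pull [Q v] F)" "pull [Q v] F \<noteq> F"
  shows "facets (deletion v (face_complex (insert v V) Q F)) \<subseteq> facets (face_complex (insert v V) Q F)"
proof
  let ?F' = "pull [Q v] F"
  fix D assume "D \<in> facets (deletion v (face_complex (insert v V) Q F))"
  then have D: "D \<in> facets (face_complex V Q ?F')" by (simp add: deletion_face_complex)
  then have D': "D \<in> face_complex V Q ?F'" "v \<notin> D"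
    using face_complex_subset by (auto simp: facets_def)
  obtain w where w: "w \<in> min_elements W S ?F'" "len w = card (V - D)"
    using facet_word_length[OF pull(1) V(1) letters_in_S(2) D] by blast
  \<comment> \<open>This says that \<open>insert v D\<close> is not a face. Otherwise a minimal
    element \<open>y\<close> of \<open>F\<close> would fit into the complement of \<open>D\<close>,
    which has only \<open>len w\<close> positions.\<close>
  have no: "D \<notin> face_complex V Q F"
  proof
    assume "D \<in> face_complex V Q F"
    then have "dem (restricted_word Q (V - D)) \<in> F" by (simp add: face_complex_def)
    then obtain y where y: "y \<in> min_elements W S F" "y \<preceq> dem (restricted_word Q (V - D))"
      using min_element_below[OF F] by blast
    then obtain ys where ys: "reduced_word W S y ys" "subseq ys (restricted_word Q (V - D))"
      using subword_property restricted_word_in_lists[OF V(1) letters_in_S(2)] by blast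
    then have "len y \<le> len w"
      using list_emb_length[OF ys(2)] w by (simp add: reduced_word_def restricted_word_def)
    \<comment> \<open>An element \<open>u\<close> gained by pulling yields a minimal
      \<open>x\<close> of \<open>F\<close> that \<open>Q v\<close> shortens: if
      \<open>pi_gen\<close> fixed \<open>x\<close>, then \<open>x \<preceq> u\<close> would put
      \<open>u\<close> into \<open>F\<close>.\<close>
    obtain u where u: "u \<in> ?F'" "u \<notin> F" using pull(2) subset_pull by blast
    then have uc: "u \<in> carrier W" and "up (Q v) u \<in> F" by (auto simp: pull_def)
    then obtain x where x: "x \<in> min_elements W S F" "x \<preceq> up (Q v) u"
      using min_element_below[OF F] by blast
    have xF: "x \<in> F" and xc: "x \<in> carrier W"
      using x order_filter_closed[OF F] by (auto simp: min_elements_def)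
    have "pi_gen W S (Q v) x \<preceq> u" using x uc xc letters_in_S by (simp add: pi_gen_le_iff)
    then have "pi_gen W S (Q v) x \<noteq> x" using u(2) order_filterD[OF F xF] by auto
    then have less: "len (pi_gen W S (Q v) x) < len x" by (auto simp: pi_gen_def split: if_splits)
    have "x \<preceq> up (Q v) (pi_gen W S (Q v) x)"
      using pi_gen_le_iff[of "Q v" x "pi_gen W S (Q v) x"] letters_in_S xc by simp
    then have "pi_gen W S (Q v) x \<in> ?F'"
      using order_filterD[OF F xF] letters_in_S xc by (simp add: pull_def)
    then obtain w' where w': "w' \<in> min_elements W S ?F'" "w' \<preceq> pi_gen W S (Q v) x"
      using min_element_below[OF pull(1)] by blast
    \<comment> \<open>Purity of both filters transfers the strict drop from \<open>x\<close> to the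
      unrelated pair \<open>y\<close> and \<open>w\<close>.\<close>
    have "len w = len w'" using w(1) w'(1) pure(2) unfolding pure_filter_def by blast
    also have "\<dots> < len x" using bruhat_len[OF w'(2)] less by auto
    also have "\<dots> = len y" using x(1) y(1) pure(1) unfolding pure_filter_def by blast
    finally show False using \<open>len y \<le> len w\<close> by simp
  qed
  show "D \<in> facets (face_complex (insert v V) Q F)"
    unfolding facets_def
  proof (intro CollectI conjI ballI impI)
    show "D \<in> face_complex (insert v V) Q F"
      using D' by (simp add: face_complex_insert_iff)
    fix E assume E: "E \<in> face_complex (insert v V) Q F" "D \<subseteq> E"
    show "E = D"
    proof (cases "v \<in> E")
      \<comment> \<open>Then \<open>E - {v}\<close> is a face for \<open>F\<close> that contains
        \<open>D\<close>, so \<open>D\<close> would be one too, against \<open>no\<close>.\<close>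
      case True
      then have "E - {v} \<in> face_complex V Q F" using E by (simp add: face_complex_insert_iff)
      moreover have "D \<subseteq> E - {v}" using E D' by auto
      ultimately show ?thesis using face_complex_mono[OF F V(1) letters_in_S(2)] no by blast
    next
      case False
      then show ?thesis using E D by (auto simp: face_complex_insert_iff facets_def)
    qed
  qed
qed

end

lemma vertex_decomposable_face_complex:
  assumes "finite V" "Q \<in> V \<rightarrow> S" "hereditarily_pure F"
  shows "vertex_decomposable (face_complex V Q F)"
  using assms
proof (induction V arbitrary: F rule: finite_linorder_min_induct)
  case empty
  have "face_complex {} Q F = {} \<or> face_complex {} Q F = {{}}" by (auto simp: face_complex_def)
  moreover have "\<exists>!D. D \<in> facets {{} :: int set}" by (simp add: facets_def)
  ultimately show ?case
    using vertex_decomposable.void vertex_decomposable.simplex by metis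
next
  case (insert v V)
  let ?F' = "pull [Q v] F"
  let ?D = "face_complex (insert v V) Q F"
  have V: "finite V" "\<And>a. a \<in> V \<Longrightarrow> v < a" and Q: "Q \<in> insert v V \<rightarrow> S" "Q v \<in> S" "Q \<in> V \<rightarrow> S"
    using insert by auto
  have hp: "hereditarily_pure ?F'" using hereditarily_pure_pull insert Q by blast
  have F: "order_filter W S F" "order_filter W S ?F'"
    using insert.prems hp by (simp_all add: hereditarily_pure_def Mac_order_filter)
  have vd: "vertex_decomposable (face_complex V Q F)" "vertex_decomposable (face_complex V Q ?F')"
    using insert.IH Q hp insert.prems by blast+
  note iff = face_complex_insert_iff[OF V Q(1) F(1)]
  note sub = face_complex_subset[OF V Q(1) F(1)]
  show ?case
  proof (cases "?F' = F")
    case True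
    have "D \<in> ?D \<longleftrightarrow> D - {v} \<in> face_complex V Q F" for D
      by (cases "v \<in> D") (simp_all add: iff True)
    then have "?D = {D. D - {v} \<in> face_complex V Q F}" by blast
    moreover have "v \<notin> \<Union>(face_complex V Q F)" using sub by blast
    ultimately show ?thesis using vertex_decomposable_cone[OF vd(1)] by simp
  next
    case False
    have pure: "pure_filter F" "pure_filter ?F'"
      using insert.prems hp hereditarily_pure_imp_pure by blast+
    note del = deletion_face_complex[OF V Q(1) F(1)]
    show ?thesis
    proof (cases "v \<in> \<Union>?D")
      case True
      then show ?thesis
      proof (rule vertex_decomposable.vertex)
        show "vertex_decomposable (deletion v ?D)" using vd del by simp
        show "vertex_decomposable (link v ?D)"
          using vd link_face_complex[OF V Q(1) F(1)] by simp
        show "facets (deletion v ?D) \<subseteq> facets ?D"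
          using facets_deletion_face_complex[OF V Q(1) F(1) pure F(2) False] .
      qed
    next
      \<comment> \<open>The rule \<open>vertex\<close> demands that \<open>v\<close> lie in a face.
        Here it lies in none, so the complex equals its deletion and the induction hypothesis for
        \<open>?F'\<close> applies.\<close>
      case False
      then have "deletion v ?D = ?D" by (auto simp: deletion_def)
      then show ?thesis using vd del by simp
    qed
  qed
qed

end

theorem theorem1p4:
  fixes W :: "('a, 'b) monoid_scheme" and S F :: "'a set"
    and V :: "int set" and Q :: "int \<Rightarrow> 'a"
  assumes "coxeter_system W S"
    and "F \<in> Mac W S"
    and "\<forall>F'\<in>Mac W S. left_le W S F' F \<longrightarrow>
           (\<forall>x\<in>min_elements W S F'. \<forall>y\<in>min_elements W S F'. cox_length W S x = cox_length W S y)"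
    and "finite V" and "Q \<in> V \<rightarrow> S"
  shows "vertex_decomposable (filter_subword_complex W S V Q F)"
proof -
  interpret coxeter W S
    using assms(1) by (intro coxeter.intro coxeter_axioms.intro) (simp_all add: coxeter_system_def)
  have F: "order_filter W S F" using assms(2) by (rule Mac_order_filter)
  have "hereditarily_pure F"
    using assms(2,3) pull_Mac left_le_pull[OF F]
    unfolding hereditarily_pure_def pure_filter_def by blast
  then show ?thesis
    using vertex_decomposable_face_complex filter_subword_complex_eq F assms(4,5) by simp
qed

end
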